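(* Let $G$ be a group, and let $\varphi\colon G\times G\to K(G)$ be the map $\varphi(a,b)=e_{ab}^{-1}e_ae_b$. Then the image of $\varphi$ generates the whole abelian group $K(G)$.
   Context: For a group $G$, $A(G)=\langle e_a,\ a\in G\mid e_ae_b=e_be_{b^{-1}ab},\ a,b\in G\rangle$, $\pi\colon A(G)\to G$ is the homomorphism $e_a\mapsto a$, and $K(G):=\operatorname{Ker}(\pi)$, which is a central (hence abelian) subgroup of $A(G)$. *)

theory Defs
  imports "HOL-Algebra.Generated_Groups"
begin

text \<open>
  A letter \<open>(x, True)\<close> stands for the generator \<open>x\<close>, a letter \<open>(x, False)\<close> for its formal inverse.
\<close>

type_synonym 'x gword = "('x \<times> bool) list"

definition gwords :: "'x set \<Rightarrow> 'x gword set" where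
  "gwords S = lists (S \<times> UNIV)"

text \<open>
  The least congruence on words over \<open>S\<close> containing free cancellation and the relations \<open>R\<close>,
  where a pair \<open>(u, v)\<close> in \<open>R\<close> stands for the relation \<open>u = v\<close>.
\<close>

inductive_set pres_cong :: "'x set \<Rightarrow> ('x gword \<times> 'x gword) set \<Rightarrow> ('x gword \<times> 'x gword) set"
  for S R where
  refl: "w \<in> gwords S \<Longrightarrow> (w, w) \<in> pres_cong S R"
| sym: "(u, v) \<in> pres_cong S R \<Longrightarrow> (v, u) \<in> pres_cong S R"
| trans: "(u, v) \<in> pres_cong S R \<Longrightarrow> (v, w) \<in> pres_cong S R \<Longrightarrow> (u, w) \<in> pres_cong S R"
| append: "(u, u') \<in> pres_cong S R \<Longrightarrow> (v, v') \<in> pres_cong S R \<Longrightarrow> (u @ v, u' @ v') \<in> pres_cong S R"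
| cancel: "x \<in> S \<Longrightarrow> ([(x, b), (x, \<not> b)], []) \<in> pres_cong S R"
| rel: "(u, v) \<in> R \<Longrightarrow> u \<in> gwords S \<Longrightarrow> v \<in> gwords S \<Longrightarrow> (u, v) \<in> pres_cong S R"

definition presented_group :: "'x set \<Rightarrow> ('x gword \<times> 'x gword) set \<Rightarrow> 'x gword set monoid" where
  "presented_group S R =
    \<lparr>carrier = gwords S // pres_cong S R,
     mult = (\<lambda>X Y. \<Union>u\<in>X. \<Union>v\<in>Y. pres_cong S R `` {u @ v}),
     one = pres_cong S R `` {[]}\<rparr>"

definition AG_rels :: "('a, 'm) monoid_scheme \<Rightarrow> ('a gword \<times> 'a gword) set" where
  "AG_rels G =
    {([(a, True), (b, True)], [(b, True), (inv\<^bsub>G\<^esub> b \<otimes>\<^bsub>G\<^esub> a \<otimes>\<^bsub>G\<^esub> b, True)]) | a b.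
       a \<in> carrier G \<and> b \<in> carrier G}"

definition AG :: "('a, 'm) monoid_scheme \<Rightarrow> 'a gword set monoid" where
  "AG G = presented_group (carrier G) (AG_rels G)"

definition AG_gen :: "('a, 'm) monoid_scheme \<Rightarrow> 'a \<Rightarrow> 'a gword set" where
  "AG_gen G a = pres_cong (carrier G) (AG_rels G) `` {[(a, True)]}"

fun word_eval :: "('a, 'm) monoid_scheme \<Rightarrow> 'a gword \<Rightarrow> 'a" where
  "word_eval G [] = \<one>\<^bsub>G\<^esub>"
| "word_eval G ((a, b) # w) = (if b then a else inv\<^bsub>G\<^esub> a) \<otimes>\<^bsub>G\<^esub> word_eval G w"

text \<open>
  All words in an element of \<open>AG G\<close> have the same value in \<open>G\<close>; \<open>AG_proj_hom\<close>, \<open>AG_proj_gen\<close> and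
  \<open>AG_proj_unique\<close> below show that this value is the homomorphism determined by the generators.
\<close>

definition AG_proj :: "('a, 'm) monoid_scheme \<Rightarrow> 'a gword set \<Rightarrow> 'a" where
  "AG_proj G X = the_elem (word_eval G ` X)"

definition KG :: "('a, 'm) monoid_scheme \<Rightarrow> 'a gword set set" where
  "KG G = kernel (AG G) G (AG_proj G)"

definition AG_phi :: "('a, 'm) monoid_scheme \<Rightarrow> 'a \<times> 'a \<Rightarrow> 'a gword set" where
  "AG_phi G = (\<lambda>(a, b). inv\<^bsub>AG G\<^esub> (AG_gen G (a \<otimes>\<^bsub>G\<^esub> b)) \<otimes>\<^bsub>AG G\<^esub> AG_gen G a \<otimes>\<^bsub>AG G\<^esub> AG_gen G b)"

lemma gwords_simps [simp]:
  "[] \<in> gwords S"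
  "p # w \<in> gwords S \<longleftrightarrow> fst p \<in> S \<and> w \<in> gwords S"
  "u @ v \<in> gwords S \<longleftrightarrow> u \<in> gwords S \<and> v \<in> gwords S"
  by (auto simp: gwords_def mem_Times_iff)

lemma pres_cong_gwords:
  assumes "(u, v) \<in> pres_cong S R"
  shows "u \<in> gwords S \<and> v \<in> gwords S"
  using assms by induction auto

lemma equiv_pres_cong: "equiv (gwords S) (pres_cong S R)"
proof (rule equivI)
  show "pres_cong S R \<subseteq> gwords S \<times> gwords S"
    using pres_cong_gwords by fast
  show "refl_on (gwords S) (pres_cong S R)"
    by (rule refl_onI) (rule pres_cong.refl)
  show "Relation.sym (pres_cong S R)"
    by (rule symI) (rule pres_cong.sym)
  show "Relation.trans (pres_cong S R)"
    by (rule transI) (rule pres_cong.trans)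
qed

lemma pres_cong_class_eq:
  "u \<in> gwords S \<Longrightarrow> v \<in> gwords S \<Longrightarrow>
    pres_cong S R `` {u} = pres_cong S R `` {v} \<longleftrightarrow> (u, v) \<in> pres_cong S R"
  by (rule eq_equiv_class_iff[OF equiv_pres_cong])

lemma presented_group_mult:
  assumes "u \<in> gwords S" "v \<in> gwords S"
  shows "pres_cong S R `` {u} \<otimes>\<^bsub>presented_group S R\<^esub> pres_cong S R `` {v} = pres_cong S R `` {u @ v}"
proof -
  have "congruent2 (pres_cong S R) (pres_cong S R) (\<lambda>u v. pres_cong S R `` {u @ v})"
    by (rule congruent2I') (metis equiv_class_eq equiv_pres_cong pres_cong.append)
  from UN_equiv_class2[OF equiv_pres_cong equiv_pres_cong this assms]
  show ?thesis by (simp add: presented_group_def)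
qed

lemma presented_group_carrierE:
  assumes "X \<in> carrier (presented_group S R)"
  obtains u where "u \<in> gwords S" "X = pres_cong S R `` {u}"
  using assms by (auto simp: presented_group_def elim: quotientE)

lemma presented_group_carrierI:
  "u \<in> gwords S \<Longrightarrow> pres_cong S R `` {u} \<in> carrier (presented_group S R)"
  by (simp add: presented_group_def quotientI)

lemma gword_left_inverse:
  assumes "u \<in> gwords S"
  shows "\<exists>v \<in> gwords S. (v @ u, []) \<in> pres_cong S R"
  using assms
proof (induction u)
  case Nil
  show ?case by (rule bexI[of _ "[]"]) (auto intro: pres_cong.refl)
next
  case (Cons p u)
  obtain x b where p: "p = (x, b)" by fastforce
  from Cons obtain v where v: "v \<in> gwords S" "(v @ u, []) \<in> pres_cong S R" by auto
  have x: "x \<in> S" and u: "u \<in> gwords S" using Cons.prems p by auto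
  have "([(x, \<not> b), (x, b)], []) \<in> pres_cong S R"
    using pres_cong.cancel[OF x, of "\<not> b"] by simp
  from pres_cong.append[OF pres_cong.refl[OF v(1)] pres_cong.append[OF this pres_cong.refl[OF u]]]
  have "(v @ [(x, \<not> b), (x, b)] @ u, v @ u) \<in> pres_cong S R" by simp
  from pres_cong.trans[OF this v(2)] show ?case
    using v x p by (intro bexI[of _ "v @ [(x, \<not> b)]"]) auto
qed

lemma group_presented_group: "group (presented_group S R)"
proof (rule groupI)
  have one: "\<one>\<^bsub>presented_group S R\<^esub> = pres_cong S R `` {[]}"
    by (simp add: presented_group_def)
  show "\<one>\<^bsub>presented_group S R\<^esub> \<in> carrier (presented_group S R)"
    by (simp add: one presented_group_carrierI)
  fix X assume "X \<in> carrier (presented_group S R)"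
  then obtain u where u: "u \<in> gwords S" "X = pres_cong S R `` {u}"
    by (rule presented_group_carrierE)
  show "\<one>\<^bsub>presented_group S R\<^esub> \<otimes>\<^bsub>presented_group S R\<^esub> X = X"
    using u by (simp add: one presented_group_mult)
  obtain v where v: "v \<in> gwords S" "(v @ u, []) \<in> pres_cong S R"
    using gword_left_inverse[OF u(1)] by blast
  show "\<exists>Y \<in> carrier (presented_group S R). Y \<otimes>\<^bsub>presented_group S R\<^esub> X = \<one>\<^bsub>presented_group S R\<^esub>"
    by (rule bexI[of _ "pres_cong S R `` {v}"])
      (use u v in \<open>simp_all add: one presented_group_mult presented_group_carrierI pres_cong_class_eq\<close>)
  fix Y assume "Y \<in> carrier (presented_group S R)"
  then obtain w where w: "w \<in> gwords S" "Y = pres_cong S R `` {w}"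
    by (rule presented_group_carrierE)
  show "X \<otimes>\<^bsub>presented_group S R\<^esub> Y \<in> carrier (presented_group S R)"
    using u w by (simp add: presented_group_mult presented_group_carrierI)
  fix Z assume "Z \<in> carrier (presented_group S R)"
  then obtain z where z: "z \<in> gwords S" "Z = pres_cong S R `` {z}"
    by (rule presented_group_carrierE)
  show "X \<otimes>\<^bsub>presented_group S R\<^esub> Y \<otimes>\<^bsub>presented_group S R\<^esub> Z =
      X \<otimes>\<^bsub>presented_group S R\<^esub> (Y \<otimes>\<^bsub>presented_group S R\<^esub> Z)"
    using u w z by (simp add: presented_group_mult)
qed

lemma group_AG: "group (AG G)"
  by (simp add: AG_def group_presented_group)

lemma AG_gen_closed: "a \<in> carrier G \<Longrightarrow> AG_gen G a \<in> carrier (AG G)"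
  by (simp add: AG_def AG_gen_def presented_group_carrierI)

lemma (in group) AG_gen_relation:
  assumes "a \<in> carrier G" "b \<in> carrier G"
  shows "AG_gen G a \<otimes>\<^bsub>AG G\<^esub> AG_gen G b = AG_gen G b \<otimes>\<^bsub>AG G\<^esub> AG_gen G (inv b \<otimes> a \<otimes> b)"
proof -
  have "([(a, True), (b, True)], [(b, True), (inv b \<otimes> a \<otimes> b, True)]) \<in> pres_cong (carrier G) (AG_rels G)"
    by (rule pres_cong.rel) (use assms in \<open>auto simp: AG_rels_def\<close>)
  then show ?thesis
    using assms by (simp add: AG_def AG_gen_def presented_group_mult pres_cong_class_eq)
qed

lemma (in group) word_eval_closed: "w \<in> gwords (carrier G) \<Longrightarrow> word_eval G w \<in> carrier G"
  by (induction w) auto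

lemma (in group) word_eval_append:
  "u \<in> gwords (carrier G) \<Longrightarrow> v \<in> gwords (carrier G) \<Longrightarrow>
    word_eval G (u @ v) = word_eval G u \<otimes> word_eval G v"
  by (induction u) (auto simp: word_eval_closed m_assoc)

lemma (in group) word_eval_cong:
  assumes "(u, v) \<in> pres_cong (carrier G) (AG_rels G)"
  shows "word_eval G u = word_eval G v"
  using assms
proof induction
  case (append u u' v v')
  then show ?case using pres_cong_gwords word_eval_append by metis
next
  case (cancel x b)
  then show ?case by (cases b) auto
next
  case (rel u v)
  then obtain a b where ab: "a \<in> carrier G" "b \<in> carrier G"
    "u = [(a, True), (b, True)]" "v = [(b, True), (inv b \<otimes> a \<otimes> b, True)]"
    by (auto simp: AG_rels_def)
  have "b \<otimes> (inv b \<otimes> a \<otimes> b) = a \<otimes> b"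
    using ab by (simp add: m_assoc[symmetric])
  then show ?case using ab by simp
qed auto

lemma (in group) AG_proj_class:
  assumes "w \<in> gwords (carrier G)"
  shows "AG_proj G (pres_cong (carrier G) (AG_rels G) `` {w}) = word_eval G w"
proof -
  have "word_eval G ` (pres_cong (carrier G) (AG_rels G) `` {w}) = {word_eval G w}"
    using word_eval_cong pres_cong.refl[OF assms] by (fastforce simp: image_iff)
  then show ?thesis by (simp add: AG_proj_def)
qed

lemma (in group) AG_proj_hom: "AG_proj G \<in> hom (AG G) G"
proof (rule homI)
  fix X assume "X \<in> carrier (AG G)"
  then obtain u where u: "u \<in> gwords (carrier G)" "X = pres_cong (carrier G) (AG_rels G) `` {u}"
    unfolding AG_def by (rule presented_group_carrierE)
  then show "AG_proj G X \<in> carrier G"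
    by (simp add: AG_proj_class word_eval_closed)
  fix Y assume "Y \<in> carrier (AG G)"
  then obtain v where v: "v \<in> gwords (carrier G)" "Y = pres_cong (carrier G) (AG_rels G) `` {v}"
    unfolding AG_def by (rule presented_group_carrierE)
  show "AG_proj G (X \<otimes>\<^bsub>AG G\<^esub> Y) = AG_proj G X \<otimes> AG_proj G Y"
    using u v by (simp add: AG_def presented_group_mult AG_proj_class word_eval_append)
qed

lemma (in group) AG_proj_gen: "a \<in> carrier G \<Longrightarrow> AG_proj G (AG_gen G a) = a"
  by (simp add: AG_gen_def AG_proj_class)

lemma (in group) AG_hom_class:
  assumes f: "f \<in> hom (AG G) G" "\<And>a. a \<in> carrier G \<Longrightarrow> f (AG_gen G a) = a"
    and w: "w \<in> gwords (carrier G)"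
  shows "f (pres_cong (carrier G) (AG_rels G) `` {w}) = word_eval G w"
proof -
  interpret A: group "AG G" by (rule group_AG)
  interpret f: group_hom "AG G" G f
    by (rule group_hom.intro[OF group_AG is_group]) (simp add: group_hom_axioms_def f)
  let ?c = "\<lambda>w. pres_cong (carrier G) (AG_rels G) `` {w}"
  have one: "?c [] = \<one>\<^bsub>AG G\<^esub>" by (simp add: AG_def presented_group_def)
  have mult: "?c u \<otimes>\<^bsub>AG G\<^esub> ?c v = ?c (u @ v)"
    if "u \<in> gwords (carrier G)" "v \<in> gwords (carrier G)" for u v
    using that by (simp add: AG_def presented_group_mult)
  have closed: "?c u \<in> carrier (AG G)" if "u \<in> gwords (carrier G)" for u
    using that by (simp add: AG_def presented_group_carrierI)
  have letter: "f (?c [(a, b)]) = (if b then a else inv a)" if a: "a \<in> carrier G" for a b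
  proof (cases b)
    case True
    then show ?thesis using f(2)[OF a] by (simp add: AG_gen_def)
  next
    case False
    have "?c [(a, False)] \<otimes>\<^bsub>AG G\<^esub> AG_gen G a = \<one>\<^bsub>AG G\<^esub>"
      using pres_cong.cancel[OF a, of False "AG_rels G"] a
      by (simp add: AG_gen_def mult one[symmetric] pres_cong_class_eq)
    then have "?c [(a, False)] = inv\<^bsub>AG G\<^esub> (AG_gen G a)"
      using a by (intro A.inv_equality[symmetric]) (auto simp: closed AG_gen_closed)
    then show ?thesis using False a f(2) by (simp add: AG_gen_closed)
  qed
  show ?thesis using w
  proof (induction w)
    case Nil
    then show ?case by (simp add: one)
  next
    case (Cons p w)
    obtain a b where p: "p = (a, b)" by fastforce
    have a: "a \<in> carrier G" and w: "w \<in> gwords (carrier G)" using Cons.prems p by auto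
    have "?c (p # w) = ?c [(a, b)] \<otimes>\<^bsub>AG G\<^esub> ?c w" using a w p by (simp add: mult)
    then have "f (?c (p # w)) = f (?c [(a, b)]) \<otimes> f (?c w)" using a w closed by simp
    then show ?case using Cons.IH[OF w] letter[OF a] p by simp
  qed
qed

lemma (in group) AG_proj_unique:
  assumes "f \<in> hom (AG G) G" "\<And>a. a \<in> carrier G \<Longrightarrow> f (AG_gen G a) = a" "X \<in> carrier (AG G)"
  shows "f X = AG_proj G X"
proof -
  obtain u where "u \<in> gwords (carrier G)" "X = pres_cong (carrier G) (AG_rels G) `` {u}"
    using assms(3) unfolding AG_def by (rule presented_group_carrierE)
  then show ?thesis using AG_hom_class[OF assms(1,2)] by (simp add: AG_proj_class)
qed

end

theory Submission
  imports Defs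
begin

text \<open>
  The identity \<open>e\<^sub>a e\<^sub>b = e\<^sub>a\<^sub>b \<phi>(a, b)\<close> moves letters into a single generator: if \<open>H\<close> is the subgroup
  generated by the image of \<open>\<phi>\<close>, multiplying \<open>e\<^sub>g h\<close> with \<open>h \<in> H\<close> from the left by \<open>e\<^sub>a\<close> or its inverse
  gives an element of the same form. Hence every \<open>x\<close> in \<open>A(G)\<close> lies in \<open>e\<^sub>g H\<close> with \<open>g = \<pi>(x)\<close>, and
  elements of the kernel lie in \<open>e\<^sub>1 H = H\<close>, because \<open>e\<^sub>1 = \<phi>(1, 1)\<close>.
\<close>

text \<open>Turns prepending a letter into left multiplication, so that an induction on words can
  use the group laws of \<open>AG G\<close>. For a negative letter, free cancellation makes the
  class of \<open>[(a, False)]\<close> a left inverse of \<open>AG_gen G a\<close>, hence its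
  inverse.\<close>

lemma AG_class_Cons:
  assumes a: "a \<in> carrier G" and w: "w \<in> gwords (carrier G)"
  shows "pres_cong (carrier G) (AG_rels G) `` {(a, b) # w} =
    (if b then AG_gen G a else inv\<^bsub>AG G\<^esub> AG_gen G a) \<otimes>\<^bsub>AG G\<^esub>
      pres_cong (carrier G) (AG_rels G) `` {w}"
proof -
  interpret A: group "AG G" by (rule group_AG)
  let ?c = "\<lambda>w. pres_cong (carrier G) (AG_rels G) `` {w}"
  have mult: "?c u \<otimes>\<^bsub>AG G\<^esub> ?c v = ?c (u @ v)"
    if "u \<in> gwords (carrier G)" "v \<in> gwords (carrier G)" for u v
    using that by (simp add: AG_def presented_group_mult)
  have "?c [(a, False)] \<otimes>\<^bsub>AG G\<^esub> AG_gen G a = ?c []"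
    using pres_cong.cancel[OF a, of False "AG_rels G"] a
    by (simp add: AG_gen_def mult pres_cong_class_eq)
  then have "?c [(a, False)] \<otimes>\<^bsub>AG G\<^esub> AG_gen G a = \<one>\<^bsub>AG G\<^esub>"
    by (simp add: AG_def presented_group_def)
  moreover have "?c [(a, False)] \<in> carrier (AG G)"
    using a by (simp add: AG_def presented_group_carrierI)
  ultimately have "inv\<^bsub>AG G\<^esub> AG_gen G a = ?c [(a, False)]"
    using a by (intro A.inv_equality) (auto simp: AG_gen_closed)
  then show ?thesis
    using a w mult[of "[(a, b)]" w] by (cases b) (simp_all add: AG_gen_def)
qed

lemma (in group) AG_phi_closed:
  assumes "a \<in> carrier G" "b \<in> carrier G"
  shows "AG_phi G (a, b) \<in> carrier (AG G)"
proof -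
  interpret A: group "AG G" by (rule group_AG)
  show ?thesis using assms by (simp add: AG_phi_def AG_gen_closed)
qed

lemma (in group) AG_gen_mult:
  assumes "a \<in> carrier G" "b \<in> carrier G"
  shows "AG_gen G a \<otimes>\<^bsub>AG G\<^esub> AG_gen G b = AG_gen G (a \<otimes> b) \<otimes>\<^bsub>AG G\<^esub> AG_phi G (a, b)"
proof -
  interpret A: group "AG G" by (rule group_AG)
  show ?thesis
    using assms by (simp add: AG_phi_def AG_gen_closed A.m_assoc[symmetric])
qed

lemma (in group) AG_phi_in_KG:
  assumes "a \<in> carrier G" "b \<in> carrier G"
  shows "AG_phi G (a, b) \<in> KG G"
proof -
  interpret p: group_hom "AG G" G "AG_proj G"
    by (rule group_hom.intro[OF group_AG is_group]) (simp add: group_hom_axioms_def AG_proj_hom)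
  have "AG_proj G (AG_phi G (a, b)) = inv (a \<otimes> b) \<otimes> a \<otimes> b"
    using assms by (simp add: AG_phi_def AG_gen_closed AG_proj_gen)
  also have "\<dots> = \<one>"
    using assms by (simp add: m_assoc)
  finally show ?thesis
    using assms by (simp add: KG_def kernel_def AG_phi_closed)
qed

text \<open>Each new letter enters from the left, next to the single generator, so its correction
  term lands between that generator and \<open>h\<close>, where \<open>?H\<close> absorbs
  it.\<close>

lemma (in group) AG_class_decomp:
  assumes "w \<in> gwords (carrier G)"
  shows "\<exists>h \<in> generate (AG G) (AG_phi G ` (carrier G \<times> carrier G)).
    pres_cong (carrier G) (AG_rels G) `` {w} = AG_gen G (word_eval G w) \<otimes>\<^bsub>AG G\<^esub> h"
  using assms
proof (induction w)
  interpret A: group "AG G" by (rule group_AG)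
  let ?H = "generate (AG G) (AG_phi G ` (carrier G \<times> carrier G))"
  interpret H: subgroup ?H "AG G"
    by (rule A.generate_is_subgroup) (auto simp: AG_phi_closed)
  have phi: "AG_phi G (a, b) \<in> ?H" if "a \<in> carrier G" "b \<in> carrier G" for a b
    using that by (auto intro: generate.incl)
  {
    case Nil
    \<comment> \<open>The empty word represents the unit, which need not be
      \<open>AG_gen G \<one>\<close>; the witness \<open>h\<close> is therefore the inverse of this
      generator.\<close>
    have "AG_phi G (\<one>, \<one>) = AG_gen G \<one>"
      by (simp add: AG_phi_def AG_gen_closed)
    then have "inv\<^bsub>AG G\<^esub> AG_gen G \<one> \<in> ?H"
      using phi[of \<one> \<one>] by simp
    moreover have "pres_cong (carrier G) (AG_rels G) `` {[]} =
        AG_gen G \<one> \<otimes>\<^bsub>AG G\<^esub> inv\<^bsub>AG G\<^esub> AG_gen G \<one>"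
      by (simp add: AG_gen_closed) (simp add: AG_def presented_group_def)
    ultimately show ?case by auto
  next
    case (Cons p w)
    obtain a b where p: "p = (a, b)" by fastforce
    have a: "a \<in> carrier G" and w: "w \<in> gwords (carrier G)" using Cons.prems p by auto
    define g where "g = word_eval G w"
    have g: "g \<in> carrier G" using w by (simp add: g_def word_eval_closed)
    obtain h where h: "h \<in> ?H"
      and wh: "pres_cong (carrier G) (AG_rels G) `` {w} = AG_gen G g \<otimes>\<^bsub>AG G\<^esub> h"
      using Cons.IH[OF w] g_def by blast
    have hA: "h \<in> carrier (AG G)" using h by (rule H.mem_carrier)
    show ?case
    proof (cases b)
      case True
      have "pres_cong (carrier G) (AG_rels G) `` {p # w} =
          (AG_gen G a \<otimes>\<^bsub>AG G\<^esub> AG_gen G g) \<otimes>\<^bsub>AG G\<^esub> h"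
        using a g w hA True by (simp add: p AG_class_Cons wh A.m_assoc AG_gen_closed)
      also have "\<dots> = AG_gen G (a \<otimes> g) \<otimes>\<^bsub>AG G\<^esub> (AG_phi G (a, g) \<otimes>\<^bsub>AG G\<^esub> h)"
        using a g hA by (simp add: AG_gen_mult A.m_assoc AG_gen_closed AG_phi_closed)
      finally show ?thesis
        using phi[OF a g] h True by (auto simp: p g_def)
    next
      case False
      \<comment> \<open>\<open>k\<close> is the value of the extended word. Since
        \<open>a \<otimes> k = g\<close>, the generator at \<open>g\<close> can be rewritten to
        start with \<open>AG_gen G a\<close>, which the negative letter then cancels; the correction
        term is now an inverse of a value of \<open>AG_phi\<close>.\<close>
      define k where "k = inv a \<otimes> g"
      have k: "k \<in> carrier G" using a g by (simp add: k_def)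
      have "a \<otimes> k = g" using a g by (simp add: k_def m_assoc[symmetric])
      then have "AG_gen G a \<otimes>\<^bsub>AG G\<^esub> AG_gen G k = AG_gen G g \<otimes>\<^bsub>AG G\<^esub> AG_phi G (a, k)"
        using AG_gen_mult[OF a k] by simp
      then have "AG_gen G g = AG_gen G a \<otimes>\<^bsub>AG G\<^esub> AG_gen G k \<otimes>\<^bsub>AG G\<^esub> inv\<^bsub>AG G\<^esub> AG_phi G (a, k)"
        using a g k by (simp add: A.m_assoc AG_gen_closed AG_phi_closed)
      then have "pres_cong (carrier G) (AG_rels G) `` {p # w} = inv\<^bsub>AG G\<^esub> AG_gen G a \<otimes>\<^bsub>AG G\<^esub>
          (AG_gen G a \<otimes>\<^bsub>AG G\<^esub> AG_gen G k \<otimes>\<^bsub>AG G\<^esub> inv\<^bsub>AG G\<^esub> AG_phi G (a, k) \<otimes>\<^bsub>AG G\<^esub> h)"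
        using a w False by (simp add: p AG_class_Cons wh)
      also have "\<dots> = AG_gen G k \<otimes>\<^bsub>AG G\<^esub> (inv\<^bsub>AG G\<^esub> AG_phi G (a, k) \<otimes>\<^bsub>AG G\<^esub> h)"
        using a k hA
        by (simp add: A.m_assoc AG_gen_closed AG_phi_closed A.inv_solve_left')
      finally show ?thesis
        using phi[OF a k] h False by (auto simp: p g_def k_def)
    qed
  }
qed

theorem proposition5p2:
  fixes G :: "('a, 'm) monoid_scheme" (structure)
  assumes "group G"
  shows "AG_phi G \<in> carrier G \<times> carrier G \<rightarrow> KG G
    \<and> generate (AG G) (AG_phi G ` (carrier G \<times> carrier G)) = KG G"
proof -
  interpret group G by (rule assms)
  interpret A: group "AG G" by (rule group_AG)
  interpret p: group_hom "AG G" G "AG_proj G"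
    by (rule group_hom.intro[OF group_AG is_group]) (simp add: group_hom_axioms_def AG_proj_hom)
  let ?H = "generate (AG G) (AG_phi G ` (carrier G \<times> carrier G))"
  interpret H: subgroup ?H "AG G"
    by (rule A.generate_is_subgroup) (auto simp: AG_phi_closed)
  have phi: "AG_phi G \<in> carrier G \<times> carrier G \<rightarrow> KG G"
    by (auto simp: AG_phi_in_KG)
  have "?H \<subseteq> KG G"
    using phi p.subgroup_kernel unfolding KG_def by (intro A.generate_subgroup_incl) blast+
  moreover have "KG G \<subseteq> ?H"
  proof
    fix X assume "X \<in> KG G"
    then have X: "X \<in> carrier (AG G)" "AG_proj G X = \<one>"
      by (auto simp: KG_def kernel_def)
    obtain w where w: "w \<in> gwords (carrier G)" "X = pres_cong (carrier G) (AG_rels G) `` {w}"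
      using X(1) unfolding AG_def by (rule presented_group_carrierE)
    \<comment> \<open>Lying in the kernel fixes the index of the generator in the decomposition of
      \<open>X\<close>, leaving two factors that both lie in \<open>?H\<close>.\<close>
    have "word_eval G w = \<one>" using X(2) w by (simp add: AG_proj_class)
    then obtain h where h: "h \<in> ?H" "X = AG_gen G \<one> \<otimes>\<^bsub>AG G\<^esub> h"
      using AG_class_decomp[OF w(1)] w(2) by auto
    have "AG_phi G (\<one>, \<one>) = AG_gen G \<one>"
      by (simp add: AG_phi_def AG_gen_closed)
    moreover have "AG_phi G (\<one>, \<one>) \<in> ?H"
      by (auto intro: generate.incl)
    ultimately show "X \<in> ?H" using h by simp
  qed
  ultimately show ?thesis using phi by blast
qed

end
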